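(* Let $M=2^{2\lambda}$ with $\lambda$ a positive integer. For $i=1,2,\dots,\sqrt M$ let $PAM\text{-}i$ denote the set of $\sqrt M$ symbols $\{(i-1)\sqrt M,\ (i-1)\sqrt M+1,\ \dots,\ (i-1)\sqrt M+(\sqrt M-1)\}$, and let $L_{PAM\text{-}i}$ be the left-cyclic $\sqrt M\times\sqrt M$ Latin Square with symbol set $PAM\text{-}i$, which removes the singular fade state $z=1$ for $\sqrt M$-PAM. Let $L_{QAM}$ be the $M\times M$ array, viewed as a $\sqrt M\times\sqrt M$ array of blocks, whose first block row is $L_{PAM\text{-}1},L_{PAM\text{-}2},\dots,L_{PAM\text{-}\sqrt M}$ and in which each block row is the blockwise left cyclic shift (by one block) of the previous block row; that is, for $r,c\in\{0,\dots,\sqrt M-1\}$, the block in block row $r$ and block column $c$ is $L_{PAM\text{-}i}$ with $i=((r+c)\bmod \sqrt M)+1$. Then $L_{QAM}$ is a Latin Square which removes the singular fade state $z=1$ for square $M$-QAM, where the rows (symbols of node A) and columns (symbols of node B) of $L_{QAM}$ are indexed by $0,\dots,M-1$ through the labelling $\mu$.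
   Context: The $\sqrt M$-PAM signal set is $P=\{-(\sqrt M-1)+2n : n=0,1,\dots,\sqrt M-1\}$, its points being labelled from left to right by $0,\dots,\sqrt M-1$. The square $M$-QAM signal set is $\mathcal{S}=\{a+jb : a,b\in P\}$ ($j=\sqrt{-1}$), with labelling $\mu:\mathcal{S}\to\{0,1,\dots,M-1\}$ given by $$\mu(a+jb)=\tfrac12\left[(\sqrt M-1+a)\sqrt M+(\sqrt M-1+b)\right].$$ A Latin Square of order $N$ is an $N\times N$ array in which each cell contains one symbol from a finite set and each symbol occurs at most once in each row and each column. A left-cyclic Latin Square is one in which each row is obtained from the previous row by a left cyclic shift by one position; $L_{PAM\text{-}i}$ has first row listing the symbols of $PAM\text{-}i$ in increasing order. A fade state is a nonzero complex number $z$; it is a singular fade state for a finite signal set $\mathcal{S}\subset\mathbb{C}$ if $\{x+z y : x,y\in\mathcal{S}\}$ has fewer than $|\mathcal{S}|^2$ elements. A Latin Square $L$ with rows and columns indexed by (labels of) $\mathcal{S}$ removes the singular fade state $z$ if $$\min\{|(x_A-x_A')+z(x_B-x_B')| : (x_A,x_B),(x_A',x_B')\in\mathcal{S}^2,\ L(x_A,x_B)\ne L(x_A',x_B')\}>0;$$ equivalently, any two pairs in $\mathcal{S}^2$ with $x_A+zx_B=x_A'+zx_B'$ hold the same symbol in $L$. *)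

theory Defs
  imports Complex_Main
begin

text \<open>
  Throughout, \<open>n\<close> is the integer \<open>\<surd>M\<close>. An \<open>N \<times> N\<close> array is a function \<open>nat \<Rightarrow> nat \<Rightarrow> 'a\<close>
  of which only the entries with row and column index below \<open>N\<close> matter.
\<close>

definition pam_point :: "nat \<Rightarrow> nat \<Rightarrow> real" where
  "pam_point n k = - (real n - 1) + 2 * real k"

definition pam_points :: "nat \<Rightarrow> real set" where
  "pam_points n = pam_point n ` {..<n}"

definition pam_set :: "nat \<Rightarrow> complex set" where
  "pam_set n = complex_of_real ` pam_points n"

definition pam_label :: "nat \<Rightarrow> complex \<Rightarrow> nat" where
  "pam_label n x = the_inv_into {..<n} (pam_point n) (Re x)"

definition qam_set :: "nat \<Rightarrow> complex set" where
  "qam_set n = {complex_of_real a + \<i> * complex_of_real b | a b. a \<in> pam_points n \<and> b \<in> pam_points n}"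

text \<open>
  The label of a QAM point is a natural number, so the floor below does not round anything
  (see \<open>of_nat_qam_label\<close>).
\<close>

definition qam_label :: "nat \<Rightarrow> complex \<Rightarrow> nat" where
  "qam_label n x =
     nat \<lfloor>(1 / 2) * ((real n - 1 + Re x) * real n + (real n - 1 + Im x))\<rfloor>"

definition latin_square :: "nat \<Rightarrow> 'a set \<Rightarrow> (nat \<Rightarrow> nat \<Rightarrow> 'a) \<Rightarrow> bool" where
  "latin_square N T L \<longleftrightarrow>
     finite T \<and>
     (\<forall>r<N. \<forall>c<N. L r c \<in> T) \<and>
     (\<forall>r<N. inj_on (\<lambda>c. L r c) {..<N}) \<and>
     (\<forall>c<N. inj_on (\<lambda>r. L r c) {..<N})"

text \<open>The array with first row \<open>f\<close>, each further row being the left cyclic shift of the previous one.\<close>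

primrec left_cyclic :: "nat \<Rightarrow> (nat \<Rightarrow> 'a) \<Rightarrow> nat \<Rightarrow> nat \<Rightarrow> 'a" where
  "left_cyclic N f 0 = f"
| "left_cyclic N f (Suc r) = (\<lambda>c. left_cyclic N f r ((c + 1) mod N))"

definition pam_symbols :: "nat \<Rightarrow> nat \<Rightarrow> nat set" where
  "pam_symbols n i = {(i - 1) * n .. (i - 1) * n + (n - 1)}"

definition L_PAM :: "nat \<Rightarrow> nat \<Rightarrow> nat \<Rightarrow> nat \<Rightarrow> nat" where
  "L_PAM n i = left_cyclic n (\<lambda>c. sorted_list_of_set (pam_symbols n i) ! c)"

text \<open>
  \<open>L_QAM_block n r c\<close> is the block in block row \<open>r\<close> and block column \<open>c\<close>; block column \<open>c\<close> of the
  first block row holds \<open>L_PAM n (c + 1)\<close>, since block columns are counted from 0 but the sets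
  \<open>pam_symbols n i\<close> from 1.
\<close>

definition L_QAM_block :: "nat \<Rightarrow> nat \<Rightarrow> nat \<Rightarrow> nat \<Rightarrow> nat \<Rightarrow> nat" where
  "L_QAM_block n = left_cyclic n (\<lambda>c. L_PAM n (c + 1))"

definition L_QAM :: "nat \<Rightarrow> nat \<Rightarrow> nat \<Rightarrow> nat" where
  "L_QAM n R C = L_QAM_block n (R div n) (C div n) (R mod n) (C mod n)"

definition singular_fade_state :: "complex set \<Rightarrow> complex \<Rightarrow> bool" where
  "singular_fade_state S z \<longleftrightarrow>
     z \<noteq> 0 \<and> card {x + z * y | x y. x \<in> S \<and> y \<in> S} < (card S)\<^sup>2"

text \<open>
  Rows and columns of \<open>L\<close> are indexed by the signal set \<open>S\<close> through the labelling \<open>lab\<close>. For finite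
  \<open>S\<close> and an array with at least two different entries, \<open>Min\<close> is taken over a finite nonempty set;
  see \<open>removes_fade_state_iff\<close>.
\<close>

definition removes_fade_state ::
  "complex set \<Rightarrow> (complex \<Rightarrow> nat) \<Rightarrow> (nat \<Rightarrow> nat \<Rightarrow> 'a) \<Rightarrow> complex \<Rightarrow> bool" where
  "removes_fade_state S lab L z \<longleftrightarrow>
     Min {cmod ((xA - xA') + z * (xB - xB')) | xA xB xA' xB'.
            xA \<in> S \<and> xB \<in> S \<and> xA' \<in> S \<and> xB' \<in> S \<and>
            L (lab xA) (lab xB) \<noteq> L (lab xA') (lab xB')} > 0"

lemma pam_label_point:
  assumes "k < n"
  shows "pam_label n (complex_of_real (pam_point n k)) = k"
proof -
  have "inj_on (pam_point n) {..<n}"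
    by (auto simp: inj_on_def pam_point_def)
  then show ?thesis
    using assms by (simp add: pam_label_def the_inv_into_f_f)
qed

lemma qam_label_point:
  "qam_label n (complex_of_real (pam_point n k) + \<i> * complex_of_real (pam_point n m)) = k * n + m"
proof -
  have "(1 / 2) * ((real n - 1 + pam_point n k) * real n + (real n - 1 + pam_point n m))
      = real_of_int (int (k * n + m))"
    by (simp add: pam_point_def algebra_simps)
  then show ?thesis
    unfolding qam_label_def by (simp del: of_nat_add of_nat_mult)
qed

lemma of_nat_qam_label:
  assumes "x \<in> qam_set n"
  shows "real (qam_label n x) = (1 / 2) * ((real n - 1 + Re x) * real n + (real n - 1 + Im x))"
proof -
  obtain k m where x: "x = complex_of_real (pam_point n k) + \<i> * complex_of_real (pam_point n m)"
    using assms by (auto simp: qam_set_def pam_points_def)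
  show ?thesis
    unfolding x qam_label_point by (simp add: pam_point_def algebra_simps)
qed

lemma left_cyclic_eq:
  assumes "c < N"
  shows "left_cyclic N f r c = f ((r + c) mod N)"
  using assms by (induction r arbitrary: c) (auto simp: mod_simps)

lemma L_PAM_eq:
  assumes "c < n"
  shows "L_PAM n i r c = (i - 1) * n + (r + c) mod n"
proof -
  have "pam_symbols n i = {(i - 1) * n ..< (i - 1) * n + n}"
    using assms by (auto simp: pam_symbols_def)
  moreover have "(r + c) mod n < n"
    using assms by simp
  ultimately show ?thesis
    using assms by (simp add: L_PAM_def left_cyclic_eq)
qed

lemma L_QAM_block_eq:
  assumes "c < n"
  shows "L_QAM_block n r c = L_PAM n ((r + c) mod n + 1)"
  using assms by (simp add: L_QAM_block_def left_cyclic_eq)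

lemma removes_fade_state_iff:
  assumes "finite S"
    and "\<exists>xA\<in>S. \<exists>xB\<in>S. \<exists>xA'\<in>S. \<exists>xB'\<in>S. L (lab xA) (lab xB) \<noteq> L (lab xA') (lab xB')"
  shows "removes_fade_state S lab L z \<longleftrightarrow>
    (\<forall>xA\<in>S. \<forall>xB\<in>S. \<forall>xA'\<in>S. \<forall>xB'\<in>S.
       xA + z * xB = xA' + z * xB' \<longrightarrow> L (lab xA) (lab xB) = L (lab xA') (lab xB'))"
proof -
  let ?g = "\<lambda>(xA, xB, xA', xB'). cmod ((xA - xA') + z * (xB - xB'))"
  let ?D = "{cmod ((xA - xA') + z * (xB - xB')) | xA xB xA' xB'.
            xA \<in> S \<and> xB \<in> S \<and> xA' \<in> S \<and> xB' \<in> S \<and>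
            L (lab xA) (lab xB) \<noteq> L (lab xA') (lab xB')}"
  have "?D \<subseteq> ?g ` (S \<times> S \<times> S \<times> S)"
    by force
  then have fin: "finite ?D"
    by (rule finite_subset) (use assms(1) in auto)
  have ne: "?D \<noteq> {}"
    using assms(2) by blast
  have eq: "xA + z * xB = xA' + z * xB' \<longleftrightarrow> (xA - xA') + z * (xB - xB') = 0" for xA xB xA' xB'
    by (auto simp: algebra_simps)
  have "removes_fade_state S lab L z \<longleftrightarrow> (\<forall>d\<in>?D. d > 0)"
    unfolding removes_fade_state_def by (rule Min_gr_iff[OF fin ne])
  also have "\<dots> \<longleftrightarrow> (\<forall>xA\<in>S. \<forall>xB\<in>S. \<forall>xA'\<in>S. \<forall>xB'\<in>S.
      L (lab xA) (lab xB) \<noteq> L (lab xA') (lab xB') \<longrightarrow> cmod ((xA - xA') + z * (xB - xB')) > 0)"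
    by blast
  finally show ?thesis
    unfolding eq zero_less_norm_iff by blast
qed

end

theory Submission
  imports Defs "HOL-Number_Theory.Cong"
begin

text \<open>
  Up to an affine change of coordinates, a PAM symbol is its label and a QAM symbol is the pair of
  quotient and remainder of its label modulo \<open>n\<close>. In these coordinates \<open>L_PAM\<close> and \<open>L_QAM\<close> are
  the addition tables of \<open>\<int>/n\<close> and \<open>(\<int>/n)\<^sup>2\<close>. The rows and columns of a group table are
  permutations, and for the fade state \<open>1\<close> the sum of two signal points determines the sum of their
  coordinates over \<open>\<int>\<close>, hence modulo \<open>n\<close>.
\<close>

lemma inj_on_add_mod: "inj_on (\<lambda>c. (a + c) mod n) {..<n}" for a n :: nat
proof (rule inj_onI)
  fix c c' assume "c \<in> {..<n}" "c' \<in> {..<n}" "(a + c) mod n = (a + c') mod n"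
  then have "[a + c = a + c'] (mod n)" "c < n" "c' < n"
    unfolding cong_def by blast+
  then show "c = c'"
    using cong_add_lcancel_nat cong_less_modulus_unique_nat by blast
qed

text \<open>The pairs \<open>(x, y)\<close> and \<open>(y, x)\<close> collide.\<close>

lemma singular_fade_state_one:
  assumes "finite S" "x \<in> S" "y \<in> S" "x \<noteq> y"
  shows "singular_fade_state S 1"
proof -
  let ?f = "\<lambda>(x, y). x + 1 * y :: complex"
  have img: "{x + 1 * y | x y. x \<in> S \<and> y \<in> S} = ?f ` (S \<times> S)"
    by force
  have "\<not> inj_on ?f (S \<times> S)"
  proof
    assume "inj_on ?f (S \<times> S)"
    then have "(x, y) = (y, x)"
      by (rule inj_onD) (use assms in auto)
    with assms show False
      by simp
  qed
  moreover have fin: "finite (S \<times> S)"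
    using assms by simp
  ultimately have "card (?f ` (S \<times> S)) < card (S \<times> S)"
    using card_image_le[OF fin, of ?f] eq_card_imp_inj_on[OF fin, of ?f] by linarith
  then show ?thesis
    by (simp only: singular_fade_state_def img card_cartesian_product power2_eq_square) simp
qed

text \<open>\<open>Min\<close> has its intended meaning only if some two cells differ. A Latin
  square of order at least 2 has different entries in the cells (0, 0) and (0, 1), and
  \<open>lab\<close> reaches both indices, so \<open>removes_fade_state_iff\<close> applies.\<close>

lemma removes_fade_state_latin_square:
  assumes "latin_square N T L" "2 \<le> N" "finite S" "lab ` S = {..<N}"
    and "\<And>xA xB xA' xB'. \<lbrakk>xA \<in> S; xB \<in> S; xA' \<in> S; xB' \<in> S; xA + z * xB = xA' + z * xB'\<rbrakk>
      \<Longrightarrow> L (lab xA) (lab xB) = L (lab xA') (lab xB')"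
  shows "removes_fade_state S lab L z"
proof -
  have "0 \<in> lab ` S" "1 \<in> lab ` S"
    using assms(2,4) by auto
  then obtain x y where xy: "x \<in> S" "lab x = 0" "y \<in> S" "lab y = 1"
    by (metis imageE)
  have "inj_on (\<lambda>c. L 0 c) {..<N}"
    using assms(1,2) by (simp add: latin_square_def)
  then have "L 0 0 \<noteq> L 0 1"
    using assms(2) by (simp add: inj_on_eq_iff[where f = "\<lambda>c. L 0 c"])
  then have "\<exists>xA\<in>S. \<exists>xB\<in>S. \<exists>xA'\<in>S. \<exists>xB'\<in>S. L (lab xA) (lab xB) \<noteq> L (lab xA') (lab xB')"
    using xy by force
  from removes_fade_state_iff[of S L lab z, OF assms(3) this] show ?thesis
    using assms(5) by blast
qed

lemma pam_set_eq: "pam_set n = (\<lambda>k. complex_of_real (pam_point n k)) ` {..<n}"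
  by (auto simp: pam_set_def pam_points_def)

lemma qam_set_eq:
  "qam_set n = (\<lambda>(k, m). complex_of_real (pam_point n k) + \<i> * complex_of_real (pam_point n m))
     ` ({..<n} \<times> {..<n})"
  by (force simp: qam_set_def pam_points_def)

text \<open>Both sides carry the same offset \<open>- 2 * (real n - 1)\<close> and the same factor
  2, so sums of points coincide exactly when sums of labels do.\<close>

lemma pam_point_add_eq_iff:
  "pam_point n k + pam_point n m = pam_point n k' + pam_point n m' \<longleftrightarrow> k + m = k' + m'"
  by (simp add: pam_point_def) linarith

lemma pam_label_image: "pam_label n ` pam_set n = {..<n}"
  by (simp add: pam_set_eq image_image pam_label_point)

text \<open>A QAM label is a two-digit number in base \<open>n\<close>, the high digit coming from
  the real part and the low digit from the imaginary part.\<close>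

lemma qam_label_image: "qam_label n ` qam_set n = {..<n * n}"
proof -
  have "qam_label n ` qam_set n = (\<lambda>(k, m). k * n + m) ` ({..<n} \<times> {..<n})"
    by (simp add: qam_set_eq image_image case_prod_unfold qam_label_point)
  also have "\<dots> = {..<n * n}"
  proof (intro equalityI subsetI)
    fix v assume "v \<in> {..<n * n}"
    then have "(v div n, v mod n) \<in> {..<n} \<times> {..<n}" "v = v div n * n + v mod n"
      by (auto simp: less_mult_imp_div_less intro!: mod_less_divisor gr0I)
    then show "v \<in> (\<lambda>(k, m). k * n + m) ` ({..<n} \<times> {..<n})"
      by (intro image_eqI[of _ _ "(v div n, v mod n)"]) simp_all
  next
    fix v assume "v \<in> (\<lambda>(k, m). k * n + m) ` ({..<n} \<times> {..<n})"
    then obtain k m where v: "v = k * n + m" and "k < n" "m < n"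
      by auto
    then have "v < Suc k * n"
      by simp
    also have "\<dots> \<le> n * n"
      using \<open>k < n\<close> by (intro mult_le_mono1) simp
    finally show "v \<in> {..<n * n}"
      by simp
  qed
  finally show ?thesis .
qed

text \<open>Addition is commutative, so in the arrays below column \<open>c\<close> repeats row
  \<open>c\<close>, and injectivity has to be checked for rows only.\<close>

lemma latin_squareI_symmetric:
  assumes "finite T" "\<And>r c. \<lbrakk>r < N; c < N\<rbrakk> \<Longrightarrow> L r c \<in> T"
    and inj: "\<And>r. r < N \<Longrightarrow> inj_on (L r) {..<N}"
    and sym: "\<And>r c. \<lbrakk>r < N; c < N\<rbrakk> \<Longrightarrow> L r c = L c r"
  shows "latin_square N T L"
proof -
  have "inj_on (\<lambda>r. L r c) {..<N}" if "c < N" for c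
    using inj[OF that] inj_on_cong[of "{..<N}" "\<lambda>r. L r c" "L c"] sym[OF _ that] by blast
  with assms(1,2) inj show ?thesis
    unfolding latin_square_def by blast
qed

lemma latin_square_L_PAM: "latin_square n (pam_symbols n i) (L_PAM n i)"
proof (rule latin_squareI_symmetric)
  show "finite (pam_symbols n i)"
    by (simp add: pam_symbols_def)
next
  fix r c assume "r < n" "c < n"
  then have "(r + c) mod n < n"
    by (intro mod_less_divisor) linarith
  then have "(r + c) mod n \<le> n - 1"
    by linarith
  with \<open>c < n\<close> show "L_PAM n i r c \<in> pam_symbols n i"
    by (simp add: L_PAM_eq pam_symbols_def)
next
  fix r
  show "inj_on (L_PAM n i r) {..<n}"
  proof (rule inj_onI)
    fix c c' assume c: "c \<in> {..<n}" "c' \<in> {..<n}" and "L_PAM n i r c = L_PAM n i r c'"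
    then have "(r + c) mod n = (r + c') mod n"
      by (simp only: L_PAM_eq lessThan_iff add_left_cancel)
    from this c show "c = c'"
      by (rule inj_onD[OF inj_on_add_mod])
  qed
qed (simp add: L_PAM_eq add.commute)

text \<open>The high digits select the block and the low digits the cell inside it. The
  \<open>+ 1\<close> that numbers the blocks from 1 cancels against \<open>i - 1\<close> in
  \<open>L_PAM_eq\<close>.\<close>

lemma L_QAM_eq:
  assumes "C < n * n"
  shows "L_QAM n R C = (R div n + C div n) mod n * n + (R mod n + C mod n) mod n"
proof -
  have "C div n < n" "C mod n < n"
    using assms by (auto simp: less_mult_imp_div_less intro!: mod_less_divisor gr0I)
  then show ?thesis
    by (simp add: L_QAM_def L_QAM_block_eq L_PAM_eq)
qed

lemma latin_square_L_QAM: "latin_square (n * n) (\<Union>i\<in>{1..n}. pam_symbols n i) (L_QAM n)"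
proof (rule latin_squareI_symmetric)
  show "finite (\<Union>i\<in>{1..n}. pam_symbols n i)"
    by (simp add: pam_symbols_def)
next
  fix R C assume "R < n * n" "C < n * n"
  then have n: "n > 0"
    by (auto intro: gr0I)
  \<comment> \<open>The block number counted from 0; the symbol sets are counted from 1, hence
    \<open>?i + 1\<close> below.\<close>
  let ?i = "(R div n + C div n) mod n"
  have "?i < n" "(R mod n + C mod n) mod n < n"
    using n by simp_all
  then have "?i < n" "(R mod n + C mod n) mod n \<le> n - 1"
    by linarith+
  then have "?i + 1 \<in> {1..n}" "L_QAM n R C \<in> pam_symbols n (?i + 1)"
    using \<open>C < n * n\<close> by (simp_all add: L_QAM_eq pam_symbols_def)
  then show "L_QAM n R C \<in> (\<Union>i\<in>{1..n}. pam_symbols n i)"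
    by blast
next
  fix R
  show "inj_on (L_QAM n R) {..<n * n}"
  proof (rule inj_onI)
    fix C C' assume C: "C \<in> {..<n * n}" "C' \<in> {..<n * n}" and eq: "L_QAM n R C = L_QAM n R C'"
    then have n: "n > 0"
      by (auto intro: gr0I)
    \<comment> \<open>An entry is itself a two-digit number, so equal entries have equal digits, and
      cancellation modulo \<open>n\<close> works in each digit separately.\<close>
    have "(R div n + C div n) mod n = L_QAM n R C div n"
      "(R div n + C' div n) mod n = L_QAM n R C' div n"
      "(R mod n + C mod n) mod n = L_QAM n R C mod n"
      "(R mod n + C' mod n) mod n = L_QAM n R C' mod n"
      using C n by (simp_all add: L_QAM_eq)
    then have "(R div n + C div n) mod n = (R div n + C' div n) mod n"
      "(R mod n + C mod n) mod n = (R mod n + C' mod n) mod n"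
      using eq by simp_all
    moreover have "C div n < n" "C' div n < n" "C mod n < n" "C' mod n < n"
      using C n by (auto simp: less_mult_imp_div_less)
    ultimately have "C div n = C' div n" "C mod n = C' mod n"
      by (auto intro: inj_onD[OF inj_on_add_mod])
    then show "C = C'"
      by (metis div_mult_mod_eq)
  qed
qed (simp add: L_QAM_eq add.commute)

lemma removes_fade_state_L_PAM:
  assumes "2 \<le> n"
  shows "removes_fade_state (pam_set n) (pam_label n) (L_PAM n i) 1"
proof (rule removes_fade_state_latin_square[OF latin_square_L_PAM assms _ pam_label_image])
  show "finite (pam_set n)"
    by (simp add: pam_set_eq)
next
  fix xA xB xA' xB'
  assume "xA \<in> pam_set n" "xB \<in> pam_set n" "xA' \<in> pam_set n" "xB' \<in> pam_set n"
    and eq: "xA + 1 * xB = xA' + 1 * xB'"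
  then obtain k m k' m' where x: "k < n" "m < n" "k' < n" "m' < n"
    "xA = complex_of_real (pam_point n k)" "xB = complex_of_real (pam_point n m)"
    "xA' = complex_of_real (pam_point n k')" "xB' = complex_of_real (pam_point n m')"
    by (auto simp: pam_set_eq)
  \<comment> \<open>PAM points are real, so the real part of the collision says everything.\<close>
  then have "k + m = k' + m'"
    using arg_cong[OF eq, of Re] by (simp add: pam_point_add_eq_iff)
  with x show "L_PAM n i (pam_label n xA) (pam_label n xB) =
      L_PAM n i (pam_label n xA') (pam_label n xB')"
    by (simp add: pam_label_point L_PAM_eq)
qed

lemma removes_fade_state_L_QAM:
  assumes "2 \<le> n"
  shows "removes_fade_state (qam_set n) (qam_label n) (L_QAM n) 1"
proof (rule removes_fade_state_latin_square[OF latin_square_L_QAM _ _ qam_label_image])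
  show "2 \<le> n * n"
    using mult_le_mono[OF assms assms] by simp
  show "finite (qam_set n)"
    by (simp add: qam_set_eq)
next
  fix xA xB xA' xB'
  assume S: "xA \<in> qam_set n" "xB \<in> qam_set n" "xA' \<in> qam_set n" "xB' \<in> qam_set n"
    and eq: "xA + 1 * xB = xA' + 1 * xB'"
  \<comment> \<open>The bound on the low digit is what lets \<open>div\<close> and
    \<open>mod\<close> recover both digits from the label \<open>k * n + m\<close>.\<close>
  obtain kA mA where A: "mA < n"
      "xA = complex_of_real (pam_point n kA) + \<i> * complex_of_real (pam_point n mA)"
    using S(1) by (auto simp: qam_set_eq)
  obtain kB mB where B: "mB < n"
      "xB = complex_of_real (pam_point n kB) + \<i> * complex_of_real (pam_point n mB)"
    using S(2) by (auto simp: qam_set_eq)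
  obtain kA' mA' where A': "mA' < n"
      "xA' = complex_of_real (pam_point n kA') + \<i> * complex_of_real (pam_point n mA')"
    using S(3) by (auto simp: qam_set_eq)
  obtain kB' mB' where B': "mB' < n"
      "xB' = complex_of_real (pam_point n kB') + \<i> * complex_of_real (pam_point n mB')"
    using S(4) by (auto simp: qam_set_eq)
  \<comment> \<open>Real and imaginary parts of the collision give the sums of the high and of the
    low digits, with no reduction modulo \<open>n\<close> yet.\<close>
  have "kA + kB = kA' + kB'" "mA + mB = mA' + mB'"
    using arg_cong[OF eq, of Re] arg_cong[OF eq, of Im]
    by (simp_all add: A B A' B' pam_point_add_eq_iff)
  moreover have "qam_label n xB < n * n" "qam_label n xB' < n * n"
    using S qam_label_image by blast+
  ultimately show "L_QAM n (qam_label n xA) (qam_label n xB) =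
      L_QAM n (qam_label n xA') (qam_label n xB')"
    using A(1) B(1) A'(1) B'(1) by (simp add: L_QAM_eq A(2) B(2) A'(2) B'(2) qam_label_point)
qed

theorem lemma8:
  fixes M n l :: nat
  assumes "l \<ge> 1"
    and "M = 2 ^ (2 * l)"
    and "real n = sqrt (real M)"
  shows "singular_fade_state (pam_set n) 1 \<and>
    (\<forall>i\<in>{1..n}. latin_square n (pam_symbols n i) (L_PAM n i) \<and>
       removes_fade_state (pam_set n) (pam_label n) (L_PAM n i) 1) \<and>
    singular_fade_state (qam_set n) 1 \<and>
    latin_square M (\<Union>i\<in>{1..n}. pam_symbols n i) (L_QAM n) \<and>
    removes_fade_state (qam_set n) (qam_label n) (L_QAM n) 1"
proof -
  have "real n = 2 ^ l"
    using assms by (simp add: power_mult real_sqrt_power power2_eq_square)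
  then have n: "n = 2 ^ l"
    by (metis of_nat_eq_iff of_nat_numeral of_nat_power)
  then have M: "M = n * n"
    by (simp add: assms(2) mult_2 power_add)
  \<comment> \<open>This is where \<open>l \<ge> 1\<close> enters: two distinct signal points are
    needed for a collision and for a nonconstant array.\<close>
  have n2: "2 \<le> n"
    using assms(1) n self_le_power[of 2 l] by simp
  \<comment> \<open>The colliding pairs are built from the two leftmost PAM points; in the QAM set
    these are taken as real parts over a common imaginary part.\<close>
  let ?p = "\<lambda>k. complex_of_real (pam_point n k)"
  have "?p 0 \<noteq> ?p 1" "?p 0 + \<i> * ?p 0 \<noteq> ?p 1 + \<i> * ?p 0"
    by (simp_all add: pam_point_def complex_eq_iff)
  moreover have "?p 0 \<in> pam_set n" "?p 1 \<in> pam_set n"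
    using n2 by (auto simp: pam_set_eq)
  moreover have "?p 0 + \<i> * ?p 0 \<in> qam_set n" "?p 1 + \<i> * ?p 0 \<in> qam_set n"
    unfolding qam_set_eq by (rule image_eqI[of _ _ "(0, 0)"] image_eqI[of _ _ "(1, 0)"]; use n2 in simp)+
  moreover have "finite (pam_set n)" "finite (qam_set n)"
    by (simp_all add: pam_set_eq qam_set_eq)
  ultimately have "singular_fade_state (pam_set n) 1" "singular_fade_state (qam_set n) 1"
    by (blast intro: singular_fade_state_one)+
  then show ?thesis
    using latin_square_L_PAM latin_square_L_QAM removes_fade_state_L_PAM[OF n2]
      removes_fade_state_L_QAM[OF n2] by (simp add: M)
qed

end
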